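(* The ceer $\omega^{(\omega)}$ is universal: for every ceer $R$, $R\leq\omega^{(\omega)}$.
   Context: A ceer is an equivalence relation on $\mathbb N$ which is computably enumerable as a subset of $\mathbb N^2$. For ceers $R_1,R_2$, $R_1\leq R_2$ means there is a total computable $f$ with $xR_1y\Leftrightarrow f(x)R_2f(y)$ for all $x,y$. Let $\varphi_e$ be the standard enumeration of partial computable functions, $\kappa(x)=\varphi_x(x)$ (partial), and $\kappa^i$ its $i$-th iterate ($\kappa^0$ the identity). The ceer $\omega^{(\omega)}$ is defined by $x\,\omega^{(\omega)}\,y\Leftrightarrow\exists i\,(\kappa^i(x)\!\downarrow\,=\kappa^i(y)\!\downarrow)$. *)

theory Defs
  imports Main "HOL-Library.Nat_Bijection"
begin

text \<open>
  Partial computable functions are the unary partial functions on \<open>nat\<close> generated by the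
  programs below. A function of several arguments is a unary function of the
  Cantor code \<^const>\<open>prod_encode\<close> of its arguments, so that composition, primitive recursion
  and minimization need no arities.
\<close>

datatype prog =
    Zero
  | Succ
  | Fst
  | Snd
  | Pair prog prog
  | Comp prog prog
  | PrimRec prog prog
  | Mu prog

text \<open>
  \<open>PrimRec p q\<close> computes \<open>h\<close> with \<open>h(a, 0) = p(a)\<close> and \<open>h(a, n + 1) = q(a, (n, h(a, n)))\<close>.
  \<open>Mu p\<close> computes the least \<open>n\<close> with \<open>p(x, n) = 0\<close>, and requires \<open>p(x, k)\<close> to be defined
  for every \<open>k < n\<close>.
\<close>

primrec run :: "prog \<Rightarrow> nat \<Rightarrow> nat option" where
  "run Zero x = Some 0"
| "run Succ x = Some (Suc x)"
| "run Fst x = Some (fst (prod_decode x))"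
| "run Snd x = Some (snd (prod_decode x))"
| "run (Pair p q) x =
     Option.bind (run p x) (\<lambda>u. Option.bind (run q x) (\<lambda>v. Some (prod_encode (u, v))))"
| "run (Comp p q) x = Option.bind (run q x) (run p)"
| "run (PrimRec p q) x =
     (let (a, n) = prod_decode x in
        rec_nat (run p a)
          (\<lambda>k r. Option.bind r (\<lambda>v. run q (prod_encode (a, prod_encode (k, v))))) n)"
| "run (Mu p) x =
     (let halts = (\<lambda>n. run p (prod_encode (x, n)) = Some 0 \<and>
                       (\<forall>k<n. \<exists>v. run p (prod_encode (x, k)) = Some v \<and> v \<noteq> 0))
      in if \<exists>n. halts n then Some (LEAST n. halts n) else None)"

primrec goedel :: "prog \<Rightarrow> nat" where
  "goedel Zero = 0"
| "goedel Succ = 1"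
| "goedel Fst = 2"
| "goedel Snd = 3"
| "goedel (Pair p q) = 4 + 4 * prod_encode (goedel p, goedel q)"
| "goedel (Comp p q) = 5 + 4 * prod_encode (goedel p, goedel q)"
| "goedel (PrimRec p q) = 6 + 4 * prod_encode (goedel p, goedel q)"
| "goedel (Mu p) = 7 + 4 * goedel p"

lemma goedel_inj: "goedel p = goedel q \<Longrightarrow> p = q"
proof (induction p arbitrary: q)
  case Zero then show ?case by (cases q) auto
next
  case Succ then show ?case by (cases q) auto
next
  case Fst then show ?case by (cases q) auto
next
  case Snd then show ?case by (cases q) auto
next
  case (Pair p1 p2) then show ?case by (cases q) (auto, presburger+)
next
  case (Comp p1 p2) then show ?case by (cases q) (auto, presburger+)
next
  case (PrimRec p1 p2) then show ?case by (cases q) (auto, presburger+)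
next
  case (Mu p) then show ?case by (cases q) (auto, presburger+)
qed

lemma goedel_surj: "\<exists>p. goedel p = n"
proof (induction n rule: less_induct)
  case (less n)
  show ?case
  proof (cases "n < 4")
    case True
    then have "n = goedel Zero \<or> n = goedel Succ \<or> n = goedel Fst \<or> n = goedel Snd"
      by auto
    then show ?thesis by metis
  next
    case False
    define m where "m = (n - 4) div 4"
    obtain a b where ab: "m = prod_encode (a, b)"
      by (metis prod_decode_inverse surj_pair)
    have "m < n" using False by (simp add: m_def)
    moreover have "a \<le> m" "b \<le> m"
      by (simp_all add: ab le_prod_encode_1 le_prod_encode_2)
    ultimately obtain p q r where "goedel p = a" "goedel q = b" "goedel r = m"
      using less.IH by (meson le_less_trans)
    then have g: "goedel (Pair p q) = 4 + 4 * m" "goedel (Comp p q) = 5 + 4 * m"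
      "goedel (PrimRec p q) = 6 + 4 * m" "goedel (Mu r) = 7 + 4 * m"
      by (simp_all add: ab)
    have "n = 4 + 4 * m \<or> n = 5 + 4 * m \<or> n = 6 + 4 * m \<or> n = 7 + 4 * m"
      using False unfolding m_def by presburger
    then show ?thesis using g by metis
  qed
qed

lemma bij_goedel: "bij goedel"
  using goedel_inj goedel_surj by (metis bijI injI surjI surj_def)

text \<open>By \<open>bij_goedel\<close>, every number codes exactly one program, and \<open>inv goedel\<close> decodes it.\<close>

definition phi :: "nat \<Rightarrow> nat \<Rightarrow> nat option" where
  "phi e = run (inv goedel e)"

definition computable :: "(nat \<Rightarrow> nat) \<Rightarrow> bool" where
  "computable f \<longleftrightarrow> (\<exists>e. \<forall>x. phi e x = Some (f x))"

text \<open>A subset of \<open>\<nat>\<^sup>2\<close> is computably enumerable if it is empty or listed by a total computable function.\<close>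

definition ce_rel :: "(nat \<times> nat) set \<Rightarrow> bool" where
  "ce_rel R \<longleftrightarrow> R = {} \<or> (\<exists>f. computable f \<and> R = range (\<lambda>n. prod_decode (f n)))"

definition ceer :: "(nat \<times> nat) set \<Rightarrow> bool" where
  "ceer R \<longleftrightarrow> equiv UNIV R \<and> ce_rel R"

definition reducible :: "(nat \<times> nat) set \<Rightarrow> (nat \<times> nat) set \<Rightarrow> bool" where
  "reducible R S \<longleftrightarrow> (\<exists>f. computable f \<and> (\<forall>x y. (x, y) \<in> R \<longleftrightarrow> (f x, f y) \<in> S))"

definition kappa :: "nat \<Rightarrow> nat option" where
  "kappa x = phi x x"

primrec kappa_iter :: "nat \<Rightarrow> nat \<Rightarrow> nat option" where
  "kappa_iter 0 x = Some x"
| "kappa_iter (Suc i) x = Option.bind (kappa_iter i x) kappa"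

definition omega_omega :: "(nat \<times> nat) set" where
  "omega_omega = {(x, y). \<exists>i z. kappa_iter i x = Some z \<and> kappa_iter i y = Some z}"

end

theory Submission imports Defs begin

text \<open>
  Choose distinct numbers \<open>diag_code t d c\<close>, one for each \<open>c\<close>, with
  \<open>\<kappa> (diag_code t d c) = diag_code t d (step c)\<close>. No recursion theorem is needed for this, because
  \<open>\<kappa>\<close> feeds a program its own code, from which the program can read off \<open>c\<close>.
  For a repetitive enumeration \<open>(a\<^sub>s, b\<^sub>s)\<close> of the ceer, let \<open>step\<close> send \<open>(r, s)\<close> to
  \<open>(min r b\<^sub>s, s + 1)\<close> if \<open>r = a\<^sub>s\<close> and to \<open>(r, s + 1)\<close> otherwise. The orbit of \<open>(x, 0)\<close> never
  leaves the class of \<open>x\<close>, and its first component decreases to a limit. The limits for equivalent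
  \<open>x\<close> and \<open>y\<close> agree, since otherwise the larger would drop when the pair of limits is
  listed again. So \<open>x \<mapsto> diag_code t d (x, 0)\<close> is the reduction.
\<close>

section \<open>Computable functions\<close>

lemma phi_goedel: "phi (goedel p) = run p"
  by (simp add: phi_def inv_f_f bij_is_inj[OF bij_goedel])

lemma computable_iff_run: "computable f \<longleftrightarrow> (\<exists>p. \<forall>x. run p x = Some (f x))"
  unfolding computable_def by (metis goedel_surj phi_goedel)

named_theorems computable_intros

lemma computable_id [computable_intros]: "computable (\<lambda>x. x)"
  unfolding computable_iff_run by (rule exI[of _ "Pair Fst Snd"]) simp

lemma computable_comp:
  assumes "computable f" "computable g"
  shows "computable (\<lambda>x. f (g x))"
proof -
  obtain p q where "\<forall>x. run p x = Some (f x)" "\<forall>x. run q x = Some (g x)"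
    using assms unfolding computable_iff_run by blast
  then show ?thesis
    unfolding computable_iff_run by (intro exI[of _ "Comp p q"]) simp
qed

lemma computable_Suc [computable_intros]:
  assumes "computable f"
  shows "computable (\<lambda>x. Suc (f x))"
proof -
  have "computable Suc"
    unfolding computable_iff_run by (rule exI[of _ Succ]) simp
  from computable_comp[OF this assms] show ?thesis .
qed

lemma computable_fst [computable_intros]:
  assumes "computable f"
  shows "computable (\<lambda>x. fst (prod_decode (f x)))"
proof -
  have "computable (\<lambda>x. fst (prod_decode x))"
    unfolding computable_iff_run by (rule exI[of _ Fst]) simp
  from computable_comp[OF this assms] show ?thesis .
qed

lemma computable_snd [computable_intros]:
  assumes "computable f"
  shows "computable (\<lambda>x. snd (prod_decode (f x)))"
proof -
  have "computable (\<lambda>x. snd (prod_decode x))"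
    unfolding computable_iff_run by (rule exI[of _ Snd]) simp
  from computable_comp[OF this assms] show ?thesis .
qed

lemma computable_pair [computable_intros]:
  assumes "computable f" "computable g"
  shows "computable (\<lambda>x. prod_encode (f x, g x))"
proof -
  obtain p q where "\<forall>x. run p x = Some (f x)" "\<forall>x. run q x = Some (g x)"
    using assms unfolding computable_iff_run by blast
  then show ?thesis
    unfolding computable_iff_run by (intro exI[of _ "Pair p q"]) simp
qed

lemma computable_const [computable_intros]: "computable (\<lambda>x. c)"
proof (induction c)
  case 0
  show ?case unfolding computable_iff_run by (rule exI[of _ Zero]) simp
next
  case (Suc c)
  then show ?case by (rule computable_Suc)
qed

lemma computable_rec_nat:
  assumes "computable f" "computable g" "computable n"
  shows "computable (\<lambda>x. rec_nat (f x) (\<lambda>k v. g (prod_encode (x, prod_encode (k, v)))) (n x))"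
proof -
  obtain p q where p: "\<And>x. run p x = Some (f x)" and q: "\<And>x. run q x = Some (g x)"
    using assms unfolding computable_iff_run by blast
  have "rec_nat (run p a)
          (\<lambda>k r. Option.bind r (\<lambda>v. run q (prod_encode (a, prod_encode (k, v))))) m =
        Some (rec_nat (f a) (\<lambda>k v. g (prod_encode (a, prod_encode (k, v)))) m)" for a m
    by (induction m) (simp_all add: p q)
  then have "computable (\<lambda>y. case prod_decode y of (a, m) \<Rightarrow>
      rec_nat (f a) (\<lambda>k v. g (prod_encode (a, prod_encode (k, v)))) m)"
    unfolding computable_iff_run
    by (intro exI[of _ "PrimRec p q"]) (simp add: split_beta)
  from computable_comp[OF this computable_pair[OF computable_id assms(3)]]
  show ?thesis by simp
qed

text \<open>Totality of \<open>f\<close> supplies the values below the minimum that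
  \<open>Mu\<close> requires, and minimality makes them nonzero; the assumed zero for every
  \<open>x\<close> makes the search end.\<close>

lemma computable_Least:
  assumes "computable f" "\<And>x. \<exists>n. f (prod_encode (x, n)) = 0"
  shows "computable (\<lambda>x. LEAST n. f (prod_encode (x, n)) = 0)"
proof -
  obtain p where p: "\<And>x. run p x = Some (f x)"
    using assms unfolding computable_iff_run by blast
  have "run (Mu p) x = Some (LEAST n. f (prod_encode (x, n)) = 0)" for x
  proof -
    let ?halts = "\<lambda>n. f (prod_encode (x, n)) = 0 \<and> (\<forall>k<n. 0 < f (prod_encode (x, k)))"
    let ?m = "LEAST n. f (prod_encode (x, n)) = 0"
    have m: "?halts ?m"
      using LeastI_ex[OF assms(2)] not_less_Least by blast
    moreover have "(LEAST n. ?halts n) = ?m"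
      using m by (intro Least_equality) (auto intro: Least_le)
    ultimately show ?thesis by (auto simp: p Let_def)
  qed
  then show ?thesis unfolding computable_iff_run by blast
qed

section \<open>Arithmetic and case distinction\<close>

lemma computable_add [computable_intros]:
  assumes "computable f" "computable g"
  shows "computable (\<lambda>x. f x + g x)"
proof -
  have eq: "rec_nat a (\<lambda>k v. Suc v) n = a + n" for a n
    by (induction n) auto
  have "computable (\<lambda>y. Suc (snd (prod_decode (snd (prod_decode y)))))"
    by (intro computable_intros)
  from computable_rec_nat[OF assms(1) this assms(2)]
  show ?thesis by (simp add: eq)
qed

lemma computable_diff [computable_intros]:
  assumes "computable f" "computable g"
  shows "computable (\<lambda>x. f x - g x)"
proof -
  have eq_pred: "rec_nat 0 (\<lambda>k v. k) n = n - 1" for n :: nat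
    by (cases n) auto
  have eq: "rec_nat a (\<lambda>k v. v - Suc 0) n = a - n" for a n :: nat
    by (induction n) auto
  have "computable (\<lambda>y. fst (prod_decode (snd (prod_decode y))))"
    by (intro computable_intros)
  from computable_rec_nat[OF computable_const[of 0] this computable_id]
  have "computable (\<lambda>n. n - 1)" by (simp add: eq_pred)
  moreover have "computable (\<lambda>y. snd (prod_decode (snd (prod_decode y))))"
    by (intro computable_intros)
  ultimately have "computable (\<lambda>y. snd (prod_decode (snd (prod_decode y))) - 1)"
    by (rule computable_comp)
  from computable_rec_nat[OF assms(1) this assms(2)]
  show ?thesis by (simp add: eq)
qed

lemma computable_if_eq [computable_intros]:
  assumes "computable a" "computable b" "computable f" "computable g"
  shows "computable (\<lambda>x. if a x = b x then f x else g x)"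
proof -
  \<comment> \<open>A recursion whose step ignores counter and previous value is a case split on
    zero. Applied to the sum of both truncated differences, it tests equality.\<close>
  have eq: "rec_nat u (\<lambda>k v. w) n = (if n = 0 then u else w)" for u w :: nat and n
    by (cases n) auto
  have "computable (\<lambda>y. g (fst (prod_decode y)))"
    by (intro computable_comp[OF assms(4)] computable_intros)
  note rec = computable_rec_nat[OF assms(3) this]
  have "computable (\<lambda>x. (a x - b x) + (b x - a x))"
    by (intro computable_intros assms)
  from rec[OF this] have "computable (\<lambda>x. if (a x - b x) + (b x - a x) = 0 then f x else g x)"
    by (simp only: eq prod_encode_inverse fst_conv)
  moreover have "(a x - b x) + (b x - a x) = 0 \<longleftrightarrow> a x = b x" for x by auto
  ultimately show ?thesis by simp
qed

lemma computable_min [computable_intros]: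
  assumes "computable f" "computable g"
  shows "computable (\<lambda>x. min (f x) (g x))"
proof -
  have "computable (\<lambda>x. f x - (f x - g x))"
    by (intro computable_intros assms)
  moreover have "f x - (f x - g x) = min (f x) (g x)" for x by simp
  ultimately show ?thesis by simp
qed

lemma computable_mult_const [computable_intros]:
  assumes "computable f"
  shows "computable (\<lambda>x. c * f x)"
  by (induction c) (simp_all add: computable_const computable_add assms)

lemma computable_div_const [computable_intros]:
  assumes "computable f" "c > 0"
  shows "computable (\<lambda>x. f x div c)"
proof -
  \<comment> \<open>The quotient is found by search: at the code of \<open>(x, n)\<close>,
    \<open>?h\<close> vanishes as soon as \<open>c * (n + 1)\<close> exceeds
    \<open>x\<close>.\<close>
  let ?h = "\<lambda>y. Suc (fst (prod_decode y)) - c * Suc (snd (prod_decode y))"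
  have iff: "Suc x - c * Suc n = 0 \<longleftrightarrow> x div c \<le> n" for x n
    using assms(2) div_less_iff_less_mult[of c x "Suc n"]
    by (simp add: less_Suc_eq_le mult.commute Suc_le_eq del: mult_Suc mult_Suc_right)
  have "computable ?h"
    by (intro computable_intros)
  from computable_Least[OF this] have "computable (\<lambda>x. LEAST n. x div c \<le> n)"
    by (simp only: iff prod_encode_inverse fst_conv snd_conv) blast
  moreover have "(LEAST n. x div c \<le> n) = x div c" for x
    by (rule Least_equality) simp_all
  ultimately have "computable (\<lambda>x. x div c)" by simp
  from computable_comp[OF this assms(1)] show ?thesis .
qed

section \<open>Prescribing the diagonal function on a family of codes\<close>

text \<open>
  Since \<open>PrimRec p q\<close> ignores \<open>q\<close> on pairs with second component \<open>0\<close>, the number \<open>c\<close> can be stored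
  in a program as the code of \<open>q\<close>. Here \<open>d\<close> is meant to code a program for \<open>x \<mapsto> (x, 0)\<close>.
\<close>

definition diag_code :: "nat \<Rightarrow> nat \<Rightarrow> nat \<Rightarrow> nat" where
  "diag_code t d c = 5 + 4 * prod_encode (6 + 4 * prod_encode (t, c), d)"

text \<open>The tags 5 and 6 in \<open>diag_code\<close> are those of \<open>Comp\<close> and
  \<open>PrimRec\<close>, so building and reading such programs becomes plain arithmetic on
  codes.\<close>

lemma diag_code_goedel:
  "diag_code (goedel p) (goedel r) (goedel q) = goedel (Comp (PrimRec p q) r)"
  by (simp add: diag_code_def)

lemma inj_diag_code: "inj (diag_code t d)"
  by (rule injI) (simp add: diag_code_def)

lemma computable_diag_code [computable_intros]:
  assumes "computable f" "computable g" "computable h"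
  shows "computable (\<lambda>x. diag_code (f x) (g x) (h x))"
  unfolding diag_code_def by (intro computable_intros assms)

text \<open>\<open>?F\<close> reads \<open>t\<close>, \<open>d\<close> and \<open>c\<close> all off
  its input, so it is defined before any program \<open>p\<close> for it is known; only afterwards
  is \<open>t\<close> taken to be the code of \<open>p\<close>.\<close>

lemma kappa_diag_code:
  assumes "computable step"
  obtains t d where "\<And>c. kappa (diag_code t d c) = Some (diag_code t d (step c))"
proof -
  let ?m = "\<lambda>x. (x - 5) div 4"
  let ?d = "\<lambda>x. snd (prod_decode (?m x))"
  let ?n = "\<lambda>x. (fst (prod_decode (?m x)) - 6) div 4"
  let ?t = "\<lambda>x. fst (prod_decode (?n x))"
  let ?c = "\<lambda>x. snd (prod_decode (?n x))"
  let ?F = "\<lambda>x. diag_code (?t x) (?d x) (step (?c x))"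
  have decode: "?t (diag_code t d c) = t" "?d (diag_code t d c) = d" "?c (diag_code t d c) = c"
    for t d c
    by (simp_all add: diag_code_def)
  have "computable ?F"
    by (intro computable_intros computable_comp[OF assms]) simp_all
  then obtain p where p: "\<And>x. run p x = Some (?F x)"
    unfolding computable_iff_run by blast
  \<comment> \<open>\<open>Pair Fst Snd\<close> is the identity, so \<open>r\<close> sends
    \<open>x\<close> to the code of \<open>(x, 0)\<close>, where \<open>PrimRec p q\<close> returns
    the value of \<open>p\<close> at \<open>x\<close> for every \<open>q\<close>.\<close>
  define r where "r = Pair (Pair Fst Snd) Zero"
  have "kappa (diag_code (goedel p) (goedel r) c) =
    Some (diag_code (goedel p) (goedel r) (step c))" for c
  proof -
    obtain q where q: "goedel q = c" using goedel_surj by blast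
    let ?x = "diag_code (goedel p) (goedel r) c"
    have "kappa ?x = run (Comp (PrimRec p q) r) ?x"
      using diag_code_goedel[of p r q] by (simp add: kappa_def phi_goedel q del: goedel.simps)
    also have "\<dots> = run p ?x"
      by (simp add: r_def)
    also have "\<dots> = Some (diag_code (goedel p) (goedel r) (step c))"
      by (simp add: p decode)
    finally show ?thesis .
  qed
  then show thesis by (rule that)
qed

lemma kappa_iter_diag_code:
  assumes "\<And>c. kappa (diag_code t d c) = Some (diag_code t d (step c))"
  shows "kappa_iter i (diag_code t d c) = Some (diag_code t d ((step ^^ i) c))"
  by (induction i) (simp_all add: assms)

lemma antimono_nat_eventually_const:
  fixes u :: "nat \<Rightarrow> nat"
  assumes "\<And>i. u (Suc i) \<le> u i"
  obtains N where "\<And>i. i \<ge> N \<Longrightarrow> u i = u N"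
proof -
  obtain N where N: "\<And>i. u N \<le> u i"
    using ex_has_least_nat[of "\<lambda>_. True" 0 u] by auto
  have "u i = u N" if "i \<ge> N" for i
    using N lift_Suc_antimono_le[of u N i] assms that by (simp add: le_antisym)
  then show thesis by (rule that)
qed

section \<open>Merging along a repetitive enumeration\<close>

primrec merge :: "(nat \<Rightarrow> nat \<times> nat) \<Rightarrow> nat \<Rightarrow> nat \<Rightarrow> nat" where
  "merge e x 0 = x"
| "merge e x (Suc s) =
     (if merge e x s = fst (e s) then min (merge e x s) (snd (e s)) else merge e x s)"

text \<open>The value changes only from the left to the right member of a listed pair, which lies in
  \<open>R\<close>, so transitivity keeps it in the class of \<open>x\<close>.\<close>

lemma merge_related:
  assumes "equiv UNIV R" "range e \<subseteq> R"
  shows "(x, merge e x s) \<in> R"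
proof (induction s)
  case 0
  show ?case using assms(1) by (simp add: equiv_def refl_on_def)
next
  case (Suc s)
  have "(fst (e s), snd (e s)) \<in> R" using assms(2) by auto
  then have "(x, snd (e s)) \<in> R" if "merge e x s = fst (e s)"
    using Suc assms(1) that by (metis equiv_def transD)
  with Suc show ?case by (auto simp: min_def)
qed

lemma merge_eventually_eq_iff:
  assumes R: "equiv UNIV R" and e: "range e = R"
    and inf: "\<And>z n. z \<in> R \<Longrightarrow> \<exists>s\<ge>n. e s = z"
  shows "(x, y) \<in> R \<longleftrightarrow> (\<exists>s. merge e x s = merge e y s)"
proof
  assume "\<exists>s. merge e x s = merge e y s"
  then show "(x, y) \<in> R"
    using merge_related[OF R] e by (metis R equiv_def order_refl symD transD)
next
  assume xy: "(x, y) \<in> R"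
  have dec: "merge e z (Suc s) \<le> merge e z s" for z s by simp
  obtain M where M: "\<And>i. i \<ge> M \<Longrightarrow> merge e x i = merge e x M"
    using antimono_nat_eventually_const[of "merge e x"] dec by blast
  obtain N where N: "\<And>i. i \<ge> N \<Longrightarrow> merge e y i = merge e y N"
    using antimono_nat_eventually_const[of "merge e y"] dec by blast
  let ?u = "merge e x M" and ?v = "merge e y N"
  have uv: "(?u, ?v) \<in> R" and vu: "(?v, ?u) \<in> R"
    using xy merge_related[OF R] e R by (metis equiv_def order_refl symD transD)+
  have "?u \<le> ?v"
  proof -
    \<comment> \<open>The pair of limits is listed after the value from \<open>x\<close> has
      settled, so the next value \<open>min ?u ?v\<close> must still be \<open>?u\<close>.\<close>
    obtain s where s: "s \<ge> M" "e s = (?u, ?v)" using inf[OF uv] by blast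
    then show ?thesis using M[of s] M[of "Suc s"] by simp
  qed
  moreover have "?v \<le> ?u"
  proof -
    obtain s where s: "s \<ge> N" "e s = (?v, ?u)" using inf[OF vu] by blast
    then show ?thesis using N[of s] N[of "Suc s"] by simp
  qed
  ultimately have "merge e x (max M N) = merge e y (max M N)"
    using M[of "max M N"] N[of "max M N"] by simp
  then show "\<exists>s. merge e x s = merge e y s" ..
qed

section \<open>The reduction of a ceer to \<open>omega_omega\<close>\<close>

theorem theorem8p13:
  fixes R :: "(nat \<times> nat) set"
  assumes "ceer R"
  shows "reducible R omega_omega"
proof -
  have R: "equiv UNIV R" using assms by (simp add: ceer_def)
  \<comment> \<open>Reflexivity rules out the empty case of \<open>ce_rel\<close>, so a listing
    function exists.\<close>
  then have "R \<noteq> {}" by (auto simp: equiv_def refl_on_def)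
  then obtain f where f: "computable f" "R = range (\<lambda>n. prod_decode (f n))"
    using assms by (auto simp: ceer_def ce_rel_def)
  \<comment> \<open>The second component of a stage is padding, so every listed pair recurs at
    arbitrarily late stages.\<close>
  define e where "e s = prod_decode (f (fst (prod_decode s)))" for s
  have inf: "\<exists>s\<ge>n. e s = z" if "z \<in> R" for z n
  proof -
    obtain k where "z = prod_decode (f k)" using \<open>z \<in> R\<close> unfolding f(2) by blast
    then have "e (prod_encode (k, n)) = z" by (simp add: e_def)
    then show ?thesis using le_prod_encode_2 by blast
  qed
  have range_e: "range e = R"
    using inf by (auto simp: e_def f(2)) (metis rangeI)
  let ?r = "\<lambda>c. fst (prod_decode c)" and ?s = "\<lambda>c. snd (prod_decode c)"
  define step where "step c = prod_encode
    (if ?r c = fst (e (?s c)) then min (?r c) (snd (e (?s c))) else ?r c, Suc (?s c))" for c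
  have "computable step"
    unfolding step_def e_def by (intro computable_intros computable_comp[OF f(1)])
  then obtain t d where td: "\<And>c. kappa (diag_code t d c) = Some (diag_code t d (step c))"
    using kappa_diag_code by blast
  define g where "g x = diag_code t d (prod_encode (x, 0))" for x
  have "computable g"
    unfolding g_def by (intro computable_intros)
  moreover have "(x, y) \<in> R \<longleftrightarrow> (g x, g y) \<in> omega_omega" for x y
  proof -
    have orbit: "(step ^^ i) (prod_encode (z, 0)) = prod_encode (merge e z i, i)" for z i
      by (induction i) (simp_all add: step_def)
    \<comment> \<open>All iterates of \<open>kappa\<close> on these codes are defined. After
      \<open>i\<close> steps both stage counters equal \<open>i\<close>, so by injectivity the codes
      agree exactly when the \<open>merge\<close> values do.\<close>
    have "(g x, g y) \<in> omega_omega \<longleftrightarrow> (\<exists>i. merge e x i = merge e y i)"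
      by (simp add: omega_omega_def g_def kappa_iter_diag_code[OF td] orbit
          inj_eq[OF inj_diag_code]) metis
    then show ?thesis
      using merge_eventually_eq_iff[OF R range_e inf] by simp
  qed
  ultimately show ?thesis unfolding reducible_def by blast
qed

end
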